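(* Let $p$ be an odd prime and let $\zeta_p:\{\xi\in\mathbb{Z}:\gcd(\xi,p)=1\}\to\{0,1\}$ be a function such that (1) if $\gcd(\theta_1,p)=\gcd(\theta_2,p)=1$ and $\theta_1\equiv\theta_2\pmod p$, then $\zeta_p(\theta_1)=\zeta_p(\theta_2)$; (2) the sets $A_i=\{a:\zeta_p(a)=i,\ 1\leq a\leq p-1\}$, $i=0,1$, satisfy $|A_0|=|A_1|=\frac{p-1}{2}$; and (3) $\zeta_p(\theta)=\frac{1+\chi_p(\theta)}{2}$ for a function $\chi_p:\{\xi\in\mathbb{Z}:\gcd(\xi,p)=1\}\to\{-1,1\}$ satisfying $\chi_p(\theta_1\theta_2)=\chi_p(\theta_1)\chi_p(\theta_2)$ for all $\theta_1,\theta_2$ relatively prime to $p$. Let $G_1$ and $G_2$ be simple graphs of the same order $\frac{p-1}{2}$ and let $f:V(G_1+G_2)\to S$ be a bijective function, where $S=\{1,2,\ldots,p-1\}$. For each $i\in\{1,2\}$ and each $j\in\{-1,1\}$, define $$\Omega_i^j=\{ab\in E(G_i):\chi_p(f(a)f(b))=j\},$$ and let $$B=\{a\in V(G_1):\chi_p(f(a))=1\}.$$ Let $\epsilon\in\{-1,0,1\}$. If $$|\Omega_1^1|+|\Omega_2^1|=|\Omega_1^{-1}|+|\Omega_2^{-1}|+\left(2|B|-\frac{p-1}{2}\right)^2+\epsilon,$$ then the join graph $G_1+G_2$ is an arithmetic cordial graph modulo $p$ under $\langle S,\zeta_p,\cdot\rangle$, where $\cdot$ is ordinary multiplication of integers.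
   Context: Join graph: $G+H$ has vertex set $V(G)\cup V(H)$ (disjoint union) and edge set $E(G)\cup E(H)\cup\{ab:a\in V(G),\ b\in V(H)\}$. Arithmetic cordial graph: let $\eta$ be a positive integer, $S\subseteq\mathbb{Z}$, $\star:S\times S\to\mathbb{Z}$ a binary function, and $\zeta_\eta:\{\xi\in\mathbb{Z}:\gcd(\xi,\eta)=1\}\to\{0,1\}$ a function. The triple $\langle S,\zeta_\eta,\star\rangle$ is called an arithmetic structure. For a simple connected graph $\Gamma$ of order $N$, a bijection $f:V(\Gamma)\to S$ (where $|S|=N$) is an arithmetic cordial labeling modulo $\eta$ under $\langle S,\zeta_\eta,\star\rangle$ if the induced function $f_\eta^*:E(\Gamma)\to\{0,1\}$, defined by $f_\eta^*(ab)=0$ if $\gcd(f(a)\star f(b),\eta)\neq 1$ or $\zeta_\eta(f(a)\star f(b))=0$, and $f_\eta^*(ab)=1$ if $\gcd(f(a)\star f(b),\eta)=1$ and $\zeta_\eta(f(a)\star f(b))=1$, satisfies $|e_{f_\eta^*}(0)-e_{f_\eta^*}(1)|\leq 1$, where $e_{f_\eta^*}(i)$ is the number of edges with label $i$. A graph admitting such a labeling is an arithmetic cordial graph modulo $\eta$ under $\langle S,\zeta_\eta,\star\rangle$. *)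

theory Defs
  imports Complex_Main "HOL-Library.FuncSet" "HOL-Computational_Algebra.Primes"
begin

section \<open>Simple graphs\<close>

record 'a ugraph =
  verts :: "'a set"
  edges :: "'a set set"

definition simple_graph :: "'a ugraph \<Rightarrow> bool" where
  "simple_graph G \<longleftrightarrow>
     finite (verts G) \<and> (\<forall>e\<in>edges G. e \<subseteq> verts G \<and> card e = 2)"

definition connected_graph :: "'a ugraph \<Rightarrow> bool" where
  "connected_graph G \<longleftrightarrow> verts G \<noteq> {} \<and>
     (\<forall>u\<in>verts G. \<forall>v\<in>verts G. (u, v) \<in> {(a, b). {a, b} \<in> edges G}\<^sup>*)"

text \<open>The sum type makes the union of the two vertex sets disjoint.\<close>

definition graph_join :: "'a ugraph \<Rightarrow> 'b ugraph \<Rightarrow> ('a + 'b) ugraph" where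
  "graph_join G H =
     \<lparr> verts = verts G <+> verts H,
       edges = (\<lambda>e. Inl ` e) ` edges G \<union> (\<lambda>e. Inr ` e) ` edges H
               \<union> {{Inl a, Inr b} | a b. a \<in> verts G \<and> b \<in> verts H} \<rparr>"

section \<open>Arithmetic cordial graphs\<close>

definition coprime_ints :: "nat \<Rightarrow> int set" where
  "coprime_ints \<eta> = {\<xi>. gcd \<xi> (int \<eta>) = 1}"

text \<open>
  Functions defined on a subset of the integers are represented by total functions; their
  values outside that subset are never used.  In particular, the operation maps
  \<open>S \<times> S\<close> into the integers by its type.
\<close>

definition arithmetic_structure ::
    "nat \<Rightarrow> int set \<Rightarrow> (int \<Rightarrow> nat) \<Rightarrow> (int \<Rightarrow> int \<Rightarrow> int) \<Rightarrow> bool" where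
  "arithmetic_structure \<eta> S \<zeta> star \<longleftrightarrow> \<eta> > 0 \<and> \<zeta> \<in> coprime_ints \<eta> \<rightarrow> {0, 1}"

definition induced_label ::
    "nat \<Rightarrow> (int \<Rightarrow> nat) \<Rightarrow> (int \<Rightarrow> int \<Rightarrow> int) \<Rightarrow> ('a \<Rightarrow> int) \<Rightarrow> 'a \<Rightarrow> 'a \<Rightarrow> nat" where
  "induced_label \<eta> \<zeta> star f a b =
     (if gcd (star (f a) (f b)) (int \<eta>) \<noteq> 1 \<or> \<zeta> (star (f a) (f b)) = 0 then 0 else 1)"

definition edges_labelled ::
    "nat \<Rightarrow> (int \<Rightarrow> nat) \<Rightarrow> (int \<Rightarrow> int \<Rightarrow> int) \<Rightarrow> 'a ugraph \<Rightarrow> ('a \<Rightarrow> int) \<Rightarrow> nat \<Rightarrow> 'a set set" where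
  "edges_labelled \<eta> \<zeta> star G f i =
     {e \<in> edges G. \<exists>a b. e = {a, b} \<and> induced_label \<eta> \<zeta> star f a b = i}"

text \<open>
  The operation need not be commutative, whereas edges are unordered, so the definition requires
  explicitly that the induced label of an edge does not depend on the order of its endpoints.
\<close>

definition arithmetic_cordial_labeling ::
    "nat \<Rightarrow> int set \<Rightarrow> (int \<Rightarrow> nat) \<Rightarrow> (int \<Rightarrow> int \<Rightarrow> int) \<Rightarrow> 'a ugraph \<Rightarrow> ('a \<Rightarrow> int) \<Rightarrow> bool" where
  "arithmetic_cordial_labeling \<eta> S \<zeta> star G f \<longleftrightarrow>
     bij_betw f (verts G) S \<and>
     (\<forall>a b. {a, b} \<in> edges G \<longrightarrow> induced_label \<eta> \<zeta> star f a b = induced_label \<eta> \<zeta> star f b a) \<and>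
     \<bar>int (card (edges_labelled \<eta> \<zeta> star G f 0))
       - int (card (edges_labelled \<eta> \<zeta> star G f 1))\<bar> \<le> 1"

definition arithmetic_cordial_graph ::
    "nat \<Rightarrow> int set \<Rightarrow> (int \<Rightarrow> nat) \<Rightarrow> (int \<Rightarrow> int \<Rightarrow> int) \<Rightarrow> 'a ugraph \<Rightarrow> bool" where
  "arithmetic_cordial_graph \<eta> S \<zeta> star G \<longleftrightarrow>
     arithmetic_structure \<eta> S \<zeta> star \<and> simple_graph G \<and> connected_graph G \<and>
     (\<exists>f. arithmetic_cordial_labeling \<eta> S \<zeta> star G f)"

text \<open>The sets \<open>\<Omega>\<^sub>i\<^sup>j\<close>; since \<open>f\<close> lives on the join, it is used composed with the injection of
  the vertices of \<open>G\<^sub>i\<close>.\<close>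

definition \<Omega> :: "(int \<Rightarrow> int) \<Rightarrow> ('a \<Rightarrow> int) \<Rightarrow> 'a ugraph \<Rightarrow> int \<Rightarrow> 'a set set" where
  "\<Omega> \<chi> f G j = {e \<in> edges G. \<exists>a b. e = {a, b} \<and> \<chi> (f a * f b) = j}"

end

theory Submission
  imports Defs
begin

text \<open>
  Give a vertex \<open>v\<close> of the join the sign \<open>w v = \<chi> (f v)\<close>.  Since \<open>\<chi>\<close> is multiplicative, the edge
  \<open>{a, b}\<close> gets label 1 or 0 according to whether the product \<open>w a * w b\<close> is \<open>1\<close> or \<open>-1\<close>.  So
  the number of edges labelled 1 minus the number of edges labelled 0 is the sum of the products
  \<open>\<Prod>v\<in>e. w v\<close> over all edges \<open>e\<close> (\<open>sum_edge_signs\<close>), and the labelling is cordial as soon as this sum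
  lies in \<open>{-1, 0, 1}\<close>.

  Over a join this sum splits (\<open>sum_edge_signs_join\<close>): the edges inside the two graphs contribute
  the differences of the cardinalities of the sets \<open>\<Omega>\<close>, and the joining edges contribute the product
  \<open>s\<^sub>1 * s\<^sub>2\<close>, where \<open>s\<^sub>i\<close> is the sum of the vertex signs of the \<open>i\<close>-th graph.  As \<open>f\<close> is a bijection
  onto a reduced residue system, on which \<open>\<chi>\<close> takes the values \<open>1\<close> and \<open>-1\<close> equally often,
  \<open>s\<^sub>1 + s\<^sub>2 = 0\<close>.  Hence the joining edges contribute \<open>-s\<^sub>1\<^sup>2\<close> with \<open>s\<^sub>1 = 2 * |B| - (p - 1) / 2\<close>.  This
  is exactly the square that the hypothesis allows the inner edges to have in excess, so
  the total is \<open>\<epsilon>\<close>.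
\<close>

section \<open>Joins of simple graphs\<close>

lemma simple_graph_finite_edges:
  assumes "simple_graph G"
  shows "finite (edges G)"
proof (rule finite_subset)
  show "edges G \<subseteq> Pow (verts G)"
    using assms by (auto simp: simple_graph_def)
  show "finite (Pow (verts G))"
    using assms by (simp add: simple_graph_def)
qed

lemma simple_graph_edge:
  assumes "simple_graph G" "{a, b} \<in> edges G"
  shows "a \<in> verts G" "b \<in> verts G" "a \<noteq> b"
proof -
  have *: "{a, b} \<subseteq> verts G" "card {a, b} = 2"
    using assms unfolding simple_graph_def by blast+
  then show "a \<in> verts G" "b \<in> verts G"
    by auto
  show "a \<noteq> b"
    using *(2) by auto
qed

lemma simple_graph_edgeE:
  assumes "simple_graph G" "e \<in> edges G"
  obtains a b where "e = {a, b}" "a \<noteq> b" "a \<in> verts G" "b \<in> verts G"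
proof -
  have "card e = 2"
    using assms by (auto simp: simple_graph_def)
  then obtain a b where "e = {a, b}"
    by (auto simp: card_2_iff)
  with that assms simple_graph_edge show ?thesis
    by metis
qed

lemma verts_graph_join: "verts (graph_join G H) = Inl ` verts G \<union> Inr ` verts H"
  by (auto simp: graph_join_def)

lemma simple_graph_join:
  assumes "simple_graph G" "simple_graph H"
  shows "simple_graph (graph_join G H)"
proof -
  have "e \<subseteq> verts (graph_join G H) \<and> card e = 2" if "e \<in> edges (graph_join G H)" for e
    using that assms
    by (auto simp: graph_join_def simple_graph_def card_image inj_on_def dest: bspec)
  moreover have "finite (verts (graph_join G H))"
    using assms by (simp add: graph_join_def simple_graph_def)
  ultimately show ?thesis
    by (simp add: simple_graph_def)
qed

text \<open>
  Vertices on different sides are adjacent; vertices on the same side have a common neighbour on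
  the other side, which is why both sides must be nonempty.
\<close>

lemma connected_graph_join:
  assumes "verts G \<noteq> {}" "verts H \<noteq> {}"
  shows "connected_graph (graph_join G H)"
proof -
  obtain a\<^sub>0 b\<^sub>0 where ab: "a\<^sub>0 \<in> verts G" "b\<^sub>0 \<in> verts H"
    using assms by blast
  define R where "R = {(x, y). {x, y} \<in> edges (graph_join G H)}"
  have lr: "(Inl a, Inr b) \<in> R" and rl: "(Inr b, Inl a) \<in> R"
    if "a \<in> verts G" "b \<in> verts H" for a b
    using that by (auto simp: R_def graph_join_def insert_commute)
  have "(u, v) \<in> R\<^sup>*" if "u \<in> verts (graph_join G H)" "v \<in> verts (graph_join G H)" for u v
  proof -
    have u: "(u, Inl a\<^sub>0) \<in> R\<^sup>*"
      using that(1) lr[OF _ ab(2)] rl[OF ab(1)] rl[OF ab]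
      by (auto simp: verts_graph_join 
          intro: r_into_rtrancl converse_rtrancl_into_rtrancl[OF _ r_into_rtrancl])
    have v: "(Inl a\<^sub>0, v) \<in> R\<^sup>*"
      using that(2) rl[OF _ ab(2)] lr[OF ab(1)] lr[OF ab]
      by (auto simp: verts_graph_join 
          intro: r_into_rtrancl converse_rtrancl_into_rtrancl[OF _ r_into_rtrancl])
    show ?thesis
      by (rule rtrancl_trans[OF u v])
  qed
  then show ?thesis
    using assms by (auto simp: connected_graph_def R_def verts_graph_join)
qed

section \<open>Sums of edge signs\<close>

lemma sum_signs:
  fixes s :: "'a \<Rightarrow> int"
  assumes "finite A" "s \<in> A \<rightarrow> {-1, 1}"
  shows "sum s A = int (card {x \<in> A. s x = 1}) - int (card {x \<in> A. s x = -1})"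
proof -
  have "sum s A = (\<Sum>x\<in>A. (if s x = 1 then 1 else 0) - (if s x = -1 then 1 else 0))"
    by (rule sum.cong) (use assms(2) in auto)
  also have "\<dots> = int (card {x \<in> A. s x = 1}) - int (card {x \<in> A. s x = -1})"
    using assms(1) by (simp add: sum_subtractf sum.If_cases Int_def)
  finally show ?thesis .
qed

lemma sum_edge_signs:
  fixes w :: "'a \<Rightarrow> int"
  assumes G: "simple_graph G" and w: "w \<in> verts G \<rightarrow> {-1, 1}"
  shows "(\<Sum>e\<in>edges G. \<Prod>v\<in>e. w v) =
    int (card {e \<in> edges G. (\<Prod>v\<in>e. w v) = 1}) - int (card {e \<in> edges G. (\<Prod>v\<in>e. w v) = -1})"
proof (rule sum_signs[OF simple_graph_finite_edges[OF G]], rule Pi_I)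
  fix e assume "e \<in> edges G"
  with G obtain a b where "e = {a, b}" "a \<noteq> b" "a \<in> verts G" "b \<in> verts G"
    by (rule simple_graph_edgeE)
  moreover from this w have "w a \<in> {-1, 1}" "w b \<in> {-1, 1}"
    by blast+
  ultimately show "(\<Prod>v\<in>e. w v) \<in> {-1, 1}"
    by auto
qed

text \<open>
  The joining edges are indexed by \<open>verts G \<times> verts H\<close>, and the sign of such an edge is the product
  of the signs of its two ends, so the double sum factors.
\<close>

lemma sum_edge_signs_join:
  fixes w :: "'a + 'b \<Rightarrow> int"
  assumes G: "simple_graph G" and H: "simple_graph H"
  shows "(\<Sum>e\<in>edges (graph_join G H). \<Prod>v\<in>e. w v) =
    (\<Sum>e\<in>edges G. \<Prod>v\<in>e. w (Inl v)) + (\<Sum>e\<in>edges H. \<Prod>v\<in>e. w (Inr v))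
    + (\<Sum>a\<in>verts G. w (Inl a)) * (\<Sum>b\<in>verts H. w (Inr b))"
proof -
  define J :: "'a \<times> 'b \<Rightarrow> ('a + 'b) set" where "J = (\<lambda>(a, b). {Inl a, Inr b})"
  let ?L = "(\<lambda>e. Inl ` e) ` edges G :: ('a + 'b) set set"
  let ?R = "(\<lambda>e. Inr ` e) ` edges H :: ('a + 'b) set set"
  let ?J = "J ` (verts G \<times> verts H)"
  let ?P = "\<lambda>e. \<Prod>v\<in>e. w v"
  have edges: "edges (graph_join G H) = ?L \<union> ?R \<union> ?J"
    by (auto simp: graph_join_def J_def)
  have fin: "finite ?L" "finite ?R" "finite ?J"
    using G H by (auto simp: simple_graph_finite_edges simple_graph_def)
  (* Only an empty edge could have the same image on both sides. *)
  have disj_LR: "?L \<inter> ?R = {}"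
  proof -
    have "Inl ` e \<noteq> (Inr ` e' :: ('a + 'b) set)" if "e \<in> edges G" for e e'
      by (rule simple_graph_edgeE[OF G that]) auto
    then show ?thesis
      by blast
  qed
  have disj_J: "(?L \<union> ?R) \<inter> ?J = {}"
    by (auto simp: J_def)
  have sumL: "sum ?P ?L = (\<Sum>e\<in>edges G. \<Prod>v\<in>e. w (Inl v))"
    by (subst sum.reindex) (auto simp: inj_on_def inj_image_eq_iff prod.reindex)
  have sumR: "sum ?P ?R = (\<Sum>e\<in>edges H. \<Prod>v\<in>e. w (Inr v))"
    by (subst sum.reindex) (auto simp: inj_on_def inj_image_eq_iff prod.reindex)
  have "inj_on J (verts G \<times> verts H)"
    by (auto simp: inj_on_def J_def doubleton_eq_iff)
  then have "sum ?P ?J = (\<Sum>(a, b)\<in>verts G \<times> verts H. w (Inl a) * w (Inr b))"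
    by (simp add: sum.reindex J_def split_def)
  also have "\<dots> = (\<Sum>a\<in>verts G. w (Inl a)) * (\<Sum>b\<in>verts H. w (Inr b))"
    by (simp add: sum_product sum.cartesian_product)
  finally have sumJ: "sum ?P ?J = \<dots>" .
  show ?thesis
    unfolding edges using fin disj_LR disj_J sumL sumR sumJ
    by (simp add: sum.union_disjoint)
qed

text \<open>
  The sets counted in the definition of cordiality, and the sets \<open>\<Omega>\<close>, ask for some way of writing
  an edge as \<open>{a, b}\<close> with a given property.  When the property depends only on the product of the
  two vertex weights, the order of the ends is irrelevant and these sets become level sets of the
  product over the edge.
\<close>

lemma edges_eq_edge_sign:
  fixes w :: "'a \<Rightarrow> int"
  assumes G: "simple_graph G"
    and P: "\<And>a b. a \<in> verts G \<Longrightarrow> b \<in> verts G \<Longrightarrow> P a b \<longleftrightarrow> w a * w b = j"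
  shows "{e \<in> edges G. \<exists>a b. e = {a, b} \<and> P a b} = {e \<in> edges G. (\<Prod>v\<in>e. w v) = j}"
proof (rule Collect_cong, rule conj_cong[OF refl])
  fix e assume e: "e \<in> edges G"
  have "P a b \<longleftrightarrow> (\<Prod>v\<in>e. w v) = j" if "e = {a, b}" for a b
    using simple_graph_edge[OF G, of a b] e that P[of a b] by simp
  moreover obtain a b where "e = {a, b}"
    using G e by (rule simple_graph_edgeE)
  ultimately show "(\<exists>a b. e = {a, b} \<and> P a b) \<longleftrightarrow> (\<Prod>v\<in>e. w v) = j"
    by blast
qed

section \<open>Arithmetic cordial labellings of joins\<close>

theorem theorem5p2:
  fixes p :: nat and \<zeta> :: "int \<Rightarrow> nat" and \<chi> :: "int \<Rightarrow> int"
    and G\<^sub>1 :: "'a ugraph" and G\<^sub>2 :: "'b ugraph"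
    and f :: "'a + 'b \<Rightarrow> int" and S :: "int set" and B :: "'a set" and \<epsilon> :: int
  assumes "prime p" and "odd p"
    and "\<zeta> \<in> coprime_ints p \<rightarrow> {0, 1}"
    and "\<And>\<theta>\<^sub>1 \<theta>\<^sub>2. gcd \<theta>\<^sub>1 (int p) = 1 \<Longrightarrow> gcd \<theta>\<^sub>2 (int p) = 1 \<Longrightarrow>
           \<theta>\<^sub>1 mod int p = \<theta>\<^sub>2 mod int p \<Longrightarrow> \<zeta> \<theta>\<^sub>1 = \<zeta> \<theta>\<^sub>2"
    and "\<And>i. i \<in> {0, 1} \<Longrightarrow> card {a \<in> {1..int p - 1}. \<zeta> a = i} = (p - 1) div 2"
    and "\<chi> \<in> coprime_ints p \<rightarrow> {-1, 1}"
    and "\<And>\<theta>\<^sub>1 \<theta>\<^sub>2. gcd \<theta>\<^sub>1 (int p) = 1 \<Longrightarrow> gcd \<theta>\<^sub>2 (int p) = 1 \<Longrightarrow>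
           \<chi> (\<theta>\<^sub>1 * \<theta>\<^sub>2) = \<chi> \<theta>\<^sub>1 * \<chi> \<theta>\<^sub>2"
    and "\<And>\<theta>. gcd \<theta> (int p) = 1 \<Longrightarrow> real (\<zeta> \<theta>) = (1 + real_of_int (\<chi> \<theta>)) / 2"
    and "simple_graph G\<^sub>1" and "simple_graph G\<^sub>2"
    and "card (verts G\<^sub>1) = (p - 1) div 2" and "card (verts G\<^sub>2) = (p - 1) div 2"
    and "S = {1..int p - 1}"
    and "bij_betw f (verts (graph_join G\<^sub>1 G\<^sub>2)) S"
    and "B = {a \<in> verts G\<^sub>1. \<chi> (f (Inl a)) = 1}"
    and "\<epsilon> \<in> {-1, 0, 1}"
    and "int (card (\<Omega> \<chi> (f \<circ> Inl) G\<^sub>1 1)) + int (card (\<Omega> \<chi> (f \<circ> Inr) G\<^sub>2 1))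
         = int (card (\<Omega> \<chi> (f \<circ> Inl) G\<^sub>1 (-1))) + int (card (\<Omega> \<chi> (f \<circ> Inr) G\<^sub>2 (-1)))
           + (2 * int (card B) - (int p - 1) div 2)\<^sup>2 + \<epsilon>"
  shows "arithmetic_cordial_graph p S \<zeta> (\<lambda>x y. x * y) (graph_join G\<^sub>1 G\<^sub>2)"
proof -
  let ?J = "graph_join G\<^sub>1 G\<^sub>2"
  define n where "n = (p - 1) div 2"
  define w where "w = (\<lambda>v. \<chi> (f v))"
  let ?P = "\<lambda>e. \<Prod>v\<in>e. w v"
  note J = simple_graph_join[OF \<open>simple_graph G\<^sub>1\<close> \<open>simple_graph G\<^sub>2\<close>]
  have p: "p \<ge> 3"
    using prime_ge_2_nat[OF \<open>prime p\<close>] \<open>odd p\<close> by (cases "p = 2") auto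
  have n: "n > 0" "(int p - 1) div 2 = int n"
    using p by (auto simp: n_def zdiv_int of_nat_diff)
  have unit: "gcd x (int p) = 1" if "x \<in> S" for x
  proof -
    have "\<not> int p dvd x"
      using that zdvd_imp_le[of "int p" x] by (auto simp: \<open>S = _\<close>)
    then have "coprime (int p) x"
      using \<open>prime p\<close> by (intro prime_imp_coprime) auto
    then show ?thesis
      by (simp add: coprime_iff_gcd_eq_1 gcd.commute)
  qed
  have \<chi>_sign: "\<chi> x = 1 \<or> \<chi> x = -1" if "gcd x (int p) = 1" for x
    using funcset_mem[OF \<open>\<chi> \<in> _\<close>, of x] that by (auto simp: coprime_ints_def)
  have \<zeta>_1: "\<zeta> x = 1 \<longleftrightarrow> \<chi> x = 1" and \<zeta>_0: "\<zeta> x = 0 \<longleftrightarrow> \<chi> x = -1" if "gcd x (int p) = 1" for x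
    using \<chi>_sign[OF that] assms(8)[OF that] by auto
  have f_in: "f v \<in> S" if "v \<in> verts ?J" for v
    using bij_betwE[OF assms(14)] that by blast
  have w_sign: "w v = 1 \<or> w v = -1" if "v \<in> verts ?J" for v
    unfolding w_def by (rule \<chi>_sign[OF unit[OF f_in[OF that]]])
  have gcd_f: "gcd (f u * f v) (int p) = 1" and w_mult: "\<chi> (f u * f v) = w u * w v"
    if "u \<in> verts ?J" "v \<in> verts ?J" for u v
    using unit[OF f_in[OF that(1)]] unit[OF f_in[OF that(2)]] assms(7)
    by (auto simp: w_def coprime_iff_gcd_eq_1[symmetric])

  (* The vertex signs of the two graphs cancel, because chi is balanced on S. *)
  define s\<^sub>1 where "s\<^sub>1 = (\<Sum>a\<in>verts G\<^sub>1. w (Inl a))"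
  define s\<^sub>2 where "s\<^sub>2 = (\<Sum>b\<in>verts G\<^sub>2. w (Inr b))"
  have fin: "finite (verts G\<^sub>1)" "finite (verts G\<^sub>2)"
    using \<open>simple_graph G\<^sub>1\<close> \<open>simple_graph G\<^sub>2\<close> by (auto simp: simple_graph_def)
  have "s\<^sub>1 + s\<^sub>2 = (\<Sum>v\<in>verts ?J. w v)"
    using fin by (simp add: s\<^sub>1_def s\<^sub>2_def graph_join_def sum.Plus)
  also have "\<dots> = (\<Sum>x\<in>S. \<chi> x)"
    unfolding w_def by (rule sum.reindex_bij_betw[OF assms(14)])
  also have "\<dots> = int (card {x \<in> S. \<chi> x = 1}) - int (card {x \<in> S. \<chi> x = -1})"
    by (rule sum_signs) (use \<chi>_sign[OF unit] in \<open>blast | simp add: assms(13)\<close>)+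
  also have "{x \<in> S. \<chi> x = 1} = {x \<in> S. \<zeta> x = 1}"
    using \<zeta>_1[OF unit] by blast
  also have "{x \<in> S. \<chi> x = -1} = {x \<in> S. \<zeta> x = 0}"
    using \<zeta>_0[OF unit] by blast
  finally have s\<^sub>2: "s\<^sub>2 = - s\<^sub>1"
    using assms(5)[of 0] assms(5)[of 1] by (simp add: \<open>S = _\<close>)
  have s\<^sub>1: "s\<^sub>1 = 2 * int (card B) - int n"
  proof -
    let ?C = "{a \<in> verts G\<^sub>1. w (Inl a) = -1}"
    have B: "B = {a \<in> verts G\<^sub>1. w (Inl a) = 1}"
      by (simp add: w_def assms(15))
    have "s\<^sub>1 = int (card B) - int (card ?C)"
      unfolding s\<^sub>1_def B using fin w_sign by (intro sum_signs) (auto simp: verts_graph_join)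
    moreover have "card B + card ?C = n"
    proof -
      have "B \<union> ?C = verts G\<^sub>1"
        unfolding B using w_sign by (auto simp: verts_graph_join)
      moreover have "card (B \<union> ?C) = card B + card ?C"
        unfolding B using fin by (intro card_Un_disjoint) auto
      ultimately show ?thesis
        by (simp add: n_def assms(11))
    qed
    ultimately show ?thesis
      by linarith
  qed

  have \<Omega>\<^sub>1: "\<Omega> \<chi> (f \<circ> Inl) G\<^sub>1 j = {e \<in> edges G\<^sub>1. (\<Prod>v\<in>e. w (Inl v)) = j}" for j
    unfolding \<Omega>_def using \<open>simple_graph G\<^sub>1\<close>
    by (rule edges_eq_edge_sign) (simp add: w_mult verts_graph_join)
  have \<Omega>\<^sub>2: "\<Omega> \<chi> (f \<circ> Inr) G\<^sub>2 j = {e \<in> edges G\<^sub>2. (\<Prod>v\<in>e. w (Inr v)) = j}" for j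
    unfolding \<Omega>_def using \<open>simple_graph G\<^sub>2\<close>
    by (rule edges_eq_edge_sign) (simp add: w_mult verts_graph_join)
  have lab_1: "edges_labelled p \<zeta> (\<lambda>x y. x * y) ?J f 1 = {e \<in> edges ?J. ?P e = 1}"
    unfolding edges_labelled_def using J
    by (rule edges_eq_edge_sign)
      (use \<zeta>_1[OF gcd_f] \<zeta>_0[OF gcd_f] \<chi>_sign[OF gcd_f] in
        \<open>force simp: induced_label_def gcd_f w_mult\<close>)
  have lab_0: "edges_labelled p \<zeta> (\<lambda>x y. x * y) ?J f 0 = {e \<in> edges ?J. ?P e = -1}"
    unfolding edges_labelled_def using J
    by (rule edges_eq_edge_sign) (simp add: induced_label_def gcd_f w_mult \<zeta>_0)

  have "int (card {e \<in> edges ?J. ?P e = 1}) - int (card {e \<in> edges ?J. ?P e = -1})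
      = (\<Sum>e\<in>edges ?J. ?P e)"
    using w_sign by (intro sum_edge_signs[OF J, symmetric]) auto
  also have "\<dots> = (\<Sum>e\<in>edges G\<^sub>1. \<Prod>v\<in>e. w (Inl v)) + (\<Sum>e\<in>edges G\<^sub>2. \<Prod>v\<in>e. w (Inr v))
      + s\<^sub>1 * s\<^sub>2"
    unfolding s\<^sub>1_def s\<^sub>2_def by (rule sum_edge_signs_join) fact+
  also have "(\<Sum>e\<in>edges G\<^sub>1. \<Prod>v\<in>e. w (Inl v)) =
      int (card (\<Omega> \<chi> (f \<circ> Inl) G\<^sub>1 1)) - int (card (\<Omega> \<chi> (f \<circ> Inl) G\<^sub>1 (-1)))"
    unfolding \<Omega>\<^sub>1 using w_sign
    by (intro sum_edge_signs[OF \<open>simple_graph G\<^sub>1\<close>]) (auto simp: verts_graph_join)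
  also have "(\<Sum>e\<in>edges G\<^sub>2. \<Prod>v\<in>e. w (Inr v)) =
      int (card (\<Omega> \<chi> (f \<circ> Inr) G\<^sub>2 1)) - int (card (\<Omega> \<chi> (f \<circ> Inr) G\<^sub>2 (-1)))"
    unfolding \<Omega>\<^sub>2 using w_sign
    by (intro sum_edge_signs[OF \<open>simple_graph G\<^sub>2\<close>]) (auto simp: verts_graph_join)
  finally have "int (card {e \<in> edges ?J. ?P e = 1}) - int (card {e \<in> edges ?J. ?P e = -1}) = \<epsilon>"
    using assms(17) unfolding n(2) s\<^sub>1[symmetric] s\<^sub>2 by (simp add: power2_eq_square o_def)
  then have balanced: "\<bar>int (card (edges_labelled p \<zeta> (\<lambda>x y. x * y) ?J f 0))
      - int (card (edges_labelled p \<zeta> (\<lambda>x y. x * y) ?J f 1))\<bar> \<le> 1"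
    unfolding lab_0 lab_1 using \<open>\<epsilon> \<in> _\<close> by auto

  have "arithmetic_structure p S \<zeta> (\<lambda>x y. x * y)"
    using p \<open>\<zeta> \<in> _\<close> by (simp add: arithmetic_structure_def)
  moreover have "connected_graph ?J"
    using n(1) assms(11,12) by (intro connected_graph_join) (auto simp: n_def)
  moreover have "arithmetic_cordial_labeling p S \<zeta> (\<lambda>x y. x * y) ?J f"
    using balanced assms(14)
    by (simp add: arithmetic_cordial_labeling_def induced_label_def mult.commute)
  ultimately show ?thesis
    using J by (auto simp: arithmetic_cordial_graph_def)
qed

end
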